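(* Let $d\ge 2$, let $\phi\in Y(\mathbb{R}^d)$ satisfy the multidimensional $\vec{\Delta}_2$ condition with constants $|||A|||_\phi$. Then for every centered $d$-dimensional random vector $\xi\in B(\phi)$ and every linear operator $A:\mathbb{R}^d\to\mathbb{R}^d$, $$\|A\xi\|B(\phi)\le |||A|||_\phi\cdot\|\xi\|B(\phi).$$
   Context: $Y(\mathbb{R}^d)$ is the set of functions $\phi:\mathbb{R}^d\to[0,\infty)$ that are even, $d$ times continuously differentiable, convex, vanish only at the origin, have zero gradient at the origin, satisfy $\det(\partial^2\phi(0)/\partial x_k\partial x_l)>0$, and satisfy $\partial^d\phi(x)/\prod_{k=1}^d\partial x_k\to\infty$ as $|x|\to\infty$. A centered (mean zero) random vector $\xi=(\xi(1),\dots,\xi(d))$ belongs to $B(\phi)$ if there is $\tau\ge0$ such that $\max_{\epsilon\in\{-1,1\}^d}\mathbf{E}\exp\big(\sum_{j}\epsilon(j)\lambda(j)\xi(j)\big)\le\exp[\phi(\tau\lambda)]$ for all $\lambda\in\mathbb{R}^d$; $\|\xi\|B(\phi)$ is the infimum of all such $\tau>0$. $\phi$ satisfies the multidimensional $\vec\Delta_2$ condition if for every matrix $A:\mathbb{R}^d\to\mathbb{R}^d$ there is a non-negative constant, denoted $|||A|||_\phi$, such that $\phi(A^*\lambda)\le\phi(|||A|||_\phi\cdot\lambda)$ for all $\lambda\in\mathbb{R}^d$, where $A^*$ is the transpose of $A$.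
   Formalization: "Even" is taken as invariance under every change of signs of the coordinates (with only φ(−x)=φ(x) the claim fails), and the mixed derivative is required to tend to infinity only as all coordinates tend to +∞, since otherwise no such φ exists. *)

theory Defs
  imports "HOL-Probability.Probability"
begin

definition partial_deriv :: "'n \<Rightarrow> (real ^ 'n \<Rightarrow> real) \<Rightarrow> real ^ 'n \<Rightarrow> real" where
  "partial_deriv k f x = deriv (\<lambda>t. f (x + t *\<^sub>R axis k 1)) 0"

fun continuously_diff :: "nat \<Rightarrow> (real ^ 'n \<Rightarrow> real) \<Rightarrow> bool" where
  "continuously_diff 0 f \<longleftrightarrow> continuous_on UNIV f"
| "continuously_diff (Suc m) f \<longleftrightarrow>
     (\<forall>x. f differentiable (at x)) \<and> (\<forall>k. continuously_diff m (partial_deriv k f))"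

text \<open>The derivative of order \<open>d = CARD('n)\<close>, once in every coordinate. For \<open>C\<^sup>d\<close> functions,
  the only ones it is used for, the order of differentiation, hence the enumeration
  chosen, is irrelevant.\<close>
definition mixed_deriv :: "(real ^ 'n \<Rightarrow> real) \<Rightarrow> real ^ 'n \<Rightarrow> real" where
  "mixed_deriv f = foldr partial_deriv (SOME ks. distinct ks \<and> set ks = (UNIV :: 'n set)) f"

definition hessian0 :: "(real ^ 'n \<Rightarrow> real) \<Rightarrow> real ^ 'n ^ 'n" where
  "hessian0 f = (\<chi> k l. partial_deriv k (partial_deriv l f) 0)"

definition signs :: "(real ^ 'n) set" where
  "signs = {\<epsilon>. \<forall>j. \<epsilon> $ j \<in> {-1, 1}}"

text \<open>Evenness is with respect to every change of signs of the coordinates, the symmetry that is built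
  into the maximum over \<open>\<epsilon>\<close> in the definition of \<open>B(\<phi>)\<close>; invariance under \<open>x \<mapsto> -x\<close> alone
  would not suffice for the bound on linear images of random vectors.

  For such a function the mixed derivative is odd in each coordinate, so it vanishes on the
  coordinate hyperplanes and cannot tend to infinity along every \<open>x\<close> with \<open>|x| \<rightarrow> \<infinity>\<close> (when
  \<open>d \<ge> 2\<close>). The growth condition is therefore imposed as all coordinates tend to \<open>+\<infinity>\<close>; by
  oddness this fixes the behaviour of its absolute value as \<open>min |x\<^sub>k| \<rightarrow> \<infinity>\<close>. It is implied by
  the condition for unrestricted \<open>|x| \<rightarrow> \<infinity>\<close>.\<close>
definition even_in_each_coordinate :: "(real ^ 'n \<Rightarrow> real) \<Rightarrow> bool" where
  "even_in_each_coordinate f \<longleftrightarrow> (\<forall>\<epsilon>\<in>signs. \<forall>x. f (\<chi> j. \<epsilon> $ j * x $ j) = f x)"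

definition Y :: "(real ^ 'n \<Rightarrow> real) set" where
  "Y = {\<phi>. (\<forall>x. 0 \<le> \<phi> x)
         \<and> even_in_each_coordinate \<phi>
         \<and> continuously_diff CARD('n) \<phi>
         \<and> convex_on UNIV \<phi>
         \<and> (\<forall>x. \<phi> x = 0 \<longleftrightarrow> x = 0)
         \<and> (\<forall>k. partial_deriv k \<phi> 0 = 0)
         \<and> 0 < det (hessian0 \<phi>)
         \<and> (\<forall>C. \<exists>R. \<forall>x. (\<forall>k. R \<le> x $ k) \<longrightarrow> C \<le> mixed_deriv \<phi> x)}"

text \<open>The expectation is a non-negative integral, so that an infinite exponential moment counts
  as \<open>\<infinity>\<close> and violates the bound.\<close>
definition B_bound ::
  "'a measure \<Rightarrow> (real ^ 'n \<Rightarrow> real) \<Rightarrow> ('a \<Rightarrow> real ^ 'n) \<Rightarrow> real \<Rightarrow> bool" where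
  "B_bound M \<phi> \<xi> \<tau> \<longleftrightarrow>
     (\<forall>\<theta>. Max ((\<lambda>\<epsilon>. \<integral>\<^sup>+\<omega>. ennreal (exp (\<Sum>j\<in>UNIV. \<epsilon> $ j * \<theta> $ j * \<xi> \<omega> $ j)) \<partial>M) ` signs)
          \<le> ennreal (exp (\<phi> (\<tau> *\<^sub>R \<theta>))))"

definition B ::
  "'a measure \<Rightarrow> (real ^ 'n \<Rightarrow> real) \<Rightarrow> ('a \<Rightarrow> real ^ 'n) set" where
  "B M \<phi> = {\<xi>. \<xi> \<in> borel_measurable M \<and> integrable M \<xi> \<and> (\<integral>\<omega>. \<xi> \<omega> \<partial>M) = 0
             \<and> (\<exists>\<tau>\<ge>0. B_bound M \<phi> \<xi> \<tau>)}"

text \<open>A real infimum: meaningful only for \<open>\<xi> \<in> B M \<phi>\<close>, where the set is non-empty.\<close>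
definition B_norm ::
  "'a measure \<Rightarrow> (real ^ 'n \<Rightarrow> real) \<Rightarrow> ('a \<Rightarrow> real ^ 'n) \<Rightarrow> real" where
  "B_norm M \<phi> \<xi> = Inf {\<tau>. 0 < \<tau> \<and> B_bound M \<phi> \<xi> \<tau>}"

text \<open>\<open>N A\<close> is the constant \<open>|||A|||\<close> of the multidimensional \<open>\<Delta>\<^sub>2\<close> condition. It is not
  required to be the least possible one.\<close>
definition vector_Delta2 ::
  "(real ^ 'n \<Rightarrow> real) \<Rightarrow> (real ^ 'n ^ 'n \<Rightarrow> real) \<Rightarrow> bool" where
  "vector_Delta2 \<phi> N \<longleftrightarrow>
     (\<forall>A. 0 \<le> N A \<and> (\<forall>\<theta>. \<phi> (transpose A *v \<theta>) \<le> \<phi> (N A *\<^sub>R \<theta>)))"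

end

theory Submission
  imports Defs
begin

text \<open>Since \<open>\<phi>\<close> is invariant under changes of signs, the maximum over \<open>\<epsilon>\<close> is redundant: the bound
  defining \<open>B(\<phi>)\<close> says \<open>E exp \<langle>\<theta>, \<xi>\<rangle> \<le> exp (\<phi> (\<tau> \<theta>))\<close> for all \<open>\<theta>\<close>. As
  \<open>\<langle>\<theta>, A \<xi>\<rangle> = \<langle>A\<^sup>T \<theta>, \<xi>\<rangle>\<close>, the \<open>\<Delta>\<^sub>2\<close> condition turns such a bound for \<open>\<xi>\<close> with \<open>\<tau>\<close> into one
  for \<open>A \<xi>\<close> with \<open>N A * \<tau>\<close>. When \<open>N A = 0\<close> this constant is not an admissible positive one,
  so the infimum is approached by increasing it, using that \<open>\<phi>\<close> is monotone along rays.\<close>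

text \<open>\<open>Max\<close> obeys its usual laws only on finite non-empty sets; this lemma and
  the next one make \<open>Max_le_iff\<close> applicable to \<open>B_bound\<close>.\<close>

lemma finite_signs: "finite (signs :: (real ^ 'n) set)"
proof (rule finite_subset)
  show "(signs :: (real ^ 'n) set) \<subseteq> vec_lambda ` (\<Pi>\<^sub>E j\<in>UNIV. {-1, 1})"
  proof
    fix e :: "real ^ 'n" assume "e \<in> signs"
    then have "vec_nth e \<in> (\<Pi>\<^sub>E j\<in>UNIV. {-1, 1})" by (auto simp: signs_def)
    then show "e \<in> vec_lambda ` (\<Pi>\<^sub>E j\<in>UNIV. {-1, 1})"
      by (metis image_eqI vec_nth_inverse)
  qed
qed (simp add: finite_PiE)

lemma one_in_signs: "1 \<in> signs"
  by (simp add: signs_def)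

text \<open>Signs can be moved from \<xi> onto \<theta>: the integral for \<epsilon> at \<theta> is
  the plain integral at the flipped \<theta>, while the right-hand side is blind to the flip. The
  choice \<epsilon> = 1 gives the other direction.\<close>

lemma B_bound_iff:
  fixes \<phi> :: "real ^ 'n \<Rightarrow> real"
  assumes "even_in_each_coordinate \<phi>"
  shows "B_bound M \<phi> \<xi> \<tau> \<longleftrightarrow>
    (\<forall>\<theta>. (\<integral>\<^sup>+\<omega>. ennreal (exp (\<theta> \<bullet> \<xi> \<omega>)) \<partial>M) \<le> ennreal (exp (\<phi> (\<tau> *\<^sub>R \<theta>))))"
    (is "_ \<longleftrightarrow> (\<forall>\<theta>. ?I \<theta> \<le> ?b \<theta>)")
proof -
  let ?flip = "\<lambda>(\<epsilon> :: real ^ 'n) (\<theta> :: real ^ 'n). \<chi> j. \<epsilon> $ j * \<theta> $ j"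
  have bound: "?b (?flip \<epsilon> \<theta>) = ?b \<theta>" if "\<epsilon> \<in> signs" for \<epsilon> \<theta>
  proof -
    have "\<tau> *\<^sub>R ?flip \<epsilon> \<theta> = ?flip \<epsilon> (\<tau> *\<^sub>R \<theta>)"
      by (simp add: vec_eq_iff)
    then show ?thesis
      using assms that unfolding even_in_each_coordinate_def by metis
  qed
  have "B_bound M \<phi> \<xi> \<tau> \<longleftrightarrow> (\<forall>\<theta>. \<forall>\<epsilon>\<in>signs. ?I (?flip \<epsilon> \<theta>) \<le> ?b \<theta>)"
  proof -
    have "(signs :: (real ^ 'n) set) \<noteq> {}"
      using one_in_signs by blast
    then show ?thesis
      by (simp add: B_bound_def inner_vec_def Max_le_iff finite_signs)
  qed
  also have "\<dots> \<longleftrightarrow> (\<forall>\<theta>. ?I \<theta> \<le> ?b \<theta>)"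
  proof
    assume le: "\<forall>\<theta>. \<forall>\<epsilon>\<in>signs. ?I (?flip \<epsilon> \<theta>) \<le> ?b \<theta>"
    show "\<forall>\<theta>. ?I \<theta> \<le> ?b \<theta>"
    proof
      fix \<theta>
      have "?flip 1 \<theta> = \<theta>"
        by (simp add: vec_eq_iff)
      then show "?I \<theta> \<le> ?b \<theta>"
        using le[rule_format, OF one_in_signs, of \<theta>] by simp
    qed
  next
    assume le: "\<forall>\<theta>. ?I \<theta> \<le> ?b \<theta>"
    show "\<forall>\<theta>. \<forall>\<epsilon>\<in>signs. ?I (?flip \<epsilon> \<theta>) \<le> ?b \<theta>"
    proof (intro allI ballI)
      fix \<theta> \<epsilon> :: "real ^ 'n"
      assume \<epsilon>: "\<epsilon> \<in> signs"
      show "?I (?flip \<epsilon> \<theta>) \<le> ?b \<theta>"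
        using le[rule_format, of "?flip \<epsilon> \<theta>"] unfolding bound[OF \<epsilon>] .
    qed
  qed
  finally show ?thesis .
qed

text \<open>For t > 0 the point s x is a convex combination of 0 and t x, with weight u = s / t
  \<le> 1 on t x. As f vanishes at 0, convexity gives f (s x) \<le> u f (t x), and f \<ge> 0 allows
  u to be dropped. If t = 0, then s = 0 too.\<close>

lemma convex_on_scaleR_mono:
  fixes f :: "'a::real_vector \<Rightarrow> real"
  assumes "convex_on UNIV f" and "f 0 = 0" and "\<And>x. 0 \<le> f x"
    and "0 \<le> s" and "s \<le> t"
  shows "f (s *\<^sub>R x) \<le> f (t *\<^sub>R x)"
proof (cases "t = 0")
  case False
  then have t: "0 < t" using assms by simp
  define u where "u = s / t"
  have u: "0 \<le> u" "u \<le> 1" "u * t = s" using t assms by (auto simp: u_def)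
  have "f ((1 - u) *\<^sub>R 0 + u *\<^sub>R (t *\<^sub>R x)) \<le> (1 - u) * f 0 + u * f (t *\<^sub>R x)"
    using convex_onD[OF assms(1)] u by blast
  then have "f (s *\<^sub>R x) \<le> u * f (t *\<^sub>R x)"
    using u assms(2) by simp
  also have "\<dots> \<le> f (t *\<^sub>R x)"
    using u assms(3) by (simp add: mult_left_le_one_le)
  finally show ?thesis .
qed (use assms in simp)

text \<open>Admissible constants can be enlarged, which serves to replace a possibly zero constant
  by a positive one.\<close>

lemma B_bound_mono:
  assumes "\<phi> \<in> Y" and "B_bound M \<phi> \<xi> s" and "0 \<le> s" and "s \<le> t"
  shows "B_bound M \<phi> \<xi> t"
proof -
  have \<phi>: "even_in_each_coordinate \<phi>" "convex_on UNIV \<phi>" "\<phi> 0 = 0" "\<And>x. 0 \<le> \<phi> x"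
    using assms(1) by (auto simp: Y_def)
  have "ennreal (exp (\<phi> (s *\<^sub>R \<theta>))) \<le> ennreal (exp (\<phi> (t *\<^sub>R \<theta>)))" for \<theta>
    using convex_on_scaleR_mono[OF \<phi>(2-4) assms(3,4)] by (simp add: ennreal_leI)
  then show ?thesis
    using assms(2) unfolding B_bound_iff[OF \<phi>(1)] by (meson order_trans)
qed

lemma B_bound_matrix_vector_mult:
  assumes "\<phi> \<in> Y" and "vector_Delta2 \<phi> N" and "B_bound M \<phi> \<xi> \<tau>"
  shows "B_bound M \<phi> (\<lambda>\<omega>. A *v \<xi> \<omega>) (N A * \<tau>)"
proof -
  have even: "even_in_each_coordinate \<phi>"
    using assms(1) by (simp add: Y_def)
  have "(\<integral>\<^sup>+\<omega>. ennreal (exp (\<theta> \<bullet> (A *v \<xi> \<omega>))) \<partial>M)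
      \<le> ennreal (exp (\<phi> ((N A * \<tau>) *\<^sub>R \<theta>)))" for \<theta>
  proof -
    have "(\<integral>\<^sup>+\<omega>. ennreal (exp (\<theta> \<bullet> (A *v \<xi> \<omega>))) \<partial>M)
        = (\<integral>\<^sup>+\<omega>. ennreal (exp ((transpose A *v \<theta>) \<bullet> \<xi> \<omega>)) \<partial>M)"
      by (simp add: dot_lmul_matrix)
    also have "\<dots> \<le> ennreal (exp (\<phi> (\<tau> *\<^sub>R (transpose A *v \<theta>))))"
      using assms(3) unfolding B_bound_iff[OF even] by blast
    \<comment> \<open>The scalar goes inside the matrix product so that the \<Delta>2 condition can
      be applied at the vector \<tau> \<theta>.\<close>
    also have "\<phi> (\<tau> *\<^sub>R (transpose A *v \<theta>)) = \<phi> (transpose A *v (\<tau> *\<^sub>R \<theta>))"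
      by (simp only: matrix_vector_mult_scaleR)
    also have "ennreal (exp \<dots>) \<le> ennreal (exp (\<phi> (N A *\<^sub>R \<tau> *\<^sub>R \<theta>)))"
      using assms(2) unfolding vector_Delta2_def by (metis ennreal_leI exp_le_cancel_iff)
    finally show ?thesis by simp
  qed
  then show ?thesis
    unfolding B_bound_iff[OF even] by blast
qed

theorem proposition5p1:
  fixes \<phi> :: "real ^ 'n \<Rightarrow> real"
    and N :: "real ^ 'n ^ 'n \<Rightarrow> real"
    and M :: "'a measure"
    and \<xi> :: "'a \<Rightarrow> real ^ 'n"
    and A :: "real ^ 'n ^ 'n"
  assumes "CARD('n) \<ge> 2"
    and "\<phi> \<in> Y"
    and "vector_Delta2 \<phi> N"
    and "prob_space M"
    and "\<xi> \<in> B M \<phi>"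
  shows "(\<lambda>\<omega>. A *v \<xi> \<omega>) \<in> B M \<phi> \<and>
    B_norm M \<phi> (\<lambda>\<omega>. A *v \<xi> \<omega>) \<le> N A * B_norm M \<phi> \<xi>"
proof
  have N: "0 \<le> N A"
    using assms(3) by (simp add: vector_Delta2_def)
  have \<xi>: "\<xi> \<in> borel_measurable M" "integrable M \<xi>" "(\<integral>\<omega>. \<xi> \<omega> \<partial>M) = 0"
    using assms(5) by (auto simp: B_def)
  obtain \<tau>\<^sub>0 where \<tau>\<^sub>0: "0 \<le> \<tau>\<^sub>0" "B_bound M \<phi> \<xi> \<tau>\<^sub>0"
    using assms(5) by (auto simp: B_def)
  note bound = B_bound_matrix_vector_mult[OF assms(2,3)]
  have lin: "bounded_linear ((*v) A)"
    by (rule matrix_vector_mul_bounded_linear)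
  have "(\<lambda>\<omega>. A *v \<xi> \<omega>) \<in> borel_measurable M"
    using integrable_bounded_linear[OF lin \<xi>(2)] by (rule borel_measurable_integrable)
  moreover have "(\<integral>\<omega>. A *v \<xi> \<omega> \<partial>M) = 0"
    using integral_bounded_linear[OF lin \<xi>(2)] \<xi>(3) by simp
  ultimately show "(\<lambda>\<omega>. A *v \<xi> \<omega>) \<in> B M \<phi>"
    using integrable_bounded_linear[OF lin \<xi>(2)] bound[OF \<tau>\<^sub>0(2)] N \<tau>\<^sub>0(1)
    by (auto simp: B_def intro!: exI[of _ "N A * \<tau>\<^sub>0"])

  let ?S = "{\<tau>. 0 < \<tau> \<and> B_bound M \<phi> \<xi> \<tau>}"
  let ?S' = "{\<tau>. 0 < \<tau> \<and> B_bound M \<phi> (\<lambda>\<omega>. A *v \<xi> \<omega>) \<tau>}"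
  have bdd: "bdd_below ?S'"
    by (rule bdd_belowI[of _ 0]) auto
  \<comment> \<open>The product \<open>N A * \<tau>\<close> vanishes if either factor does, and then
    lies outside \<open>?S'\<close>; adding any e > 0 puts it inside.\<close>
  have le: "Inf ?S' \<le> N A * \<tau>" if "0 \<le> \<tau>" "B_bound M \<phi> \<xi> \<tau>" for \<tau>
  proof (rule field_le_epsilon)
    fix e :: real assume "0 < e"
    then have "N A * \<tau> + e \<in> ?S'"
      using N that bound[OF that(2)] B_bound_mono[OF assms(2), of M _ "N A * \<tau>"]
      by (simp add: add_nonneg_pos)
    then show "Inf ?S' \<le> N A * \<tau> + e"
      using bdd by (rule cInf_lower)
  qed
  have "Inf ?S' \<le> N A * Inf ?S"
  \<comment> \<open>If \<open>N A = 0\<close>, the right-hand side is 0 and a single admissible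
    constant suffices. Otherwise dividing by \<open>N A\<close> turns \<open>le\<close> into a lower
    bound for all of \<open>?S\<close>.\<close>
  proof (cases "N A = 0")
    case True
    then show ?thesis
      using le[OF \<tau>\<^sub>0] by simp
  next
    case False
    \<comment> \<open>\<open>cInf_greatest\<close> requires \<open>?S\<close> to be non-empty;
      \<open>\<tau>\<^sub>0\<close> itself may be 0, hence the shift by 1.\<close>
    have "\<tau>\<^sub>0 + 1 \<in> ?S"
      using \<tau>\<^sub>0 B_bound_mono[OF assms(2), of M \<xi> \<tau>\<^sub>0] by simp
    then have "Inf ?S' / N A \<le> Inf ?S"
      using le N False by (intro cInf_greatest) (auto simp: divide_le_eq mult.commute)
    then show ?thesis
      using N False by (simp add: divide_le_eq mult.commute)
  qed
  then show "B_norm M \<phi> (\<lambda>\<omega>. A *v \<xi> \<omega>) \<le> N A * B_norm M \<phi> \<xi>"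
    by (simp add: B_norm_def)
qed

end
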